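(* Let $k$ be a positive integer and suppose $A, B \in \mathcal{M}_n^{+}$ have factor width at most $k$. Then $A \odot B$ has factor width at most $k$. Furthermore, $\mathrm{fran}_k(A \odot B) \leq \mathrm{fran}_k(A)\,\mathrm{fran}_k(B)$.
   Context: Let $\mathbb{F} \in \{\mathbb{R},\mathbb{C}\}$ (the result holds for either field). $\mathcal{M}_n^{+}$ denotes the set of $n \times n$ positive semidefinite (real symmetric if $\mathbb{F}=\mathbb{R}$, Hermitian if $\mathbb{F}=\mathbb{C}$) matrices over $\mathbb{F}$. $A \odot B$ is the Hadamard (entrywise) product, with $(i,j)$-entry $a_{i,j}b_{i,j}$. The factor width of $A \in \mathcal{M}_n^{+}$ is the smallest positive integer $k$ such that $A = \sum_{j=1}^r \mathbf{v}_j\mathbf{v}_j^*$ for some $r$ and some $\mathbf{v}_1,\ldots,\mathbf{v}_r \in \mathbb{F}^n$, each with at most $k$ non-zero entries. If $A$ has factor width at most $k$, $\mathrm{fran}_k(A)$ (the factor-width-$k$ rank) is the least integer $r$ for which such a decomposition with vectors having at most $k$ non-zero entries exists (the zero matrix being an empty sum, $r=0$). *)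

theory Defs
  imports
    "HOL-Analysis.Analysis"
    "HOL-Library.Extended_Nat"
    "Jordan_Normal_Form.Conjugate"
begin

text \<open>
  The definitions are generic over a field with a conjugation \<open>conjugate\<close>, which is the identity
  on \<open>real\<close> and \<open>cnj\<close> on \<open>complex\<close>.  On \<open>complex\<close>, \<open>0 \<le> z\<close> means that \<open>z\<close> is real and
  nonnegative.
\<close>

definition hermitian :: "'a::conjugatable_field^'n^'n \<Rightarrow> bool" where
  "hermitian A \<longleftrightarrow> (\<forall>i j. A $ i $ j = conjugate (A $ j $ i))"

definition psd :: "'a::conjugatable_ordered_field^'n^'n \<Rightarrow> bool" where
  "psd A \<longleftrightarrow> hermitian A \<and> (\<forall>x. 0 \<le> (\<Sum>i\<in>UNIV. conjugate (x $ i) * (A *v x) $ i))"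

definition hadamard :: "'a::times^'n^'m \<Rightarrow> 'a^'n^'m \<Rightarrow> 'a^'n^'m"  (infixl "\<odot>" 70) where
  "A \<odot> B = (\<chi> i j. A $ i $ j * B $ i $ j)"

definition outer :: "'a::conjugatable_field^'n \<Rightarrow> 'a^'n^'n" where
  "outer v = (\<chi> i j. v $ i * conjugate (v $ j))"

definition nonzero_entries :: "'a::zero^'n \<Rightarrow> nat" where
  "nonzero_entries v = card {i. v $ i \<noteq> 0}"

definition fw_decomposable :: "nat \<Rightarrow> nat \<Rightarrow> 'a::conjugatable_field^'n^'n \<Rightarrow> bool" where
  "fw_decomposable k r A \<longleftrightarrow>
     (\<exists>v :: nat \<Rightarrow> 'a^'n. (\<forall>j<r. nonzero_entries (v j) \<le> k) \<and> A = (\<Sum>j<r. outer (v j)))"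

text \<open>
  Both minima below are infima in \<open>enat\<close>: an infimum of a nonempty set of naturals is attained,
  and the infimum of the empty set is \<open>\<infinity>\<close>, so a finite bound on either quantity entails that a
  decomposition exists.
\<close>

definition factor_width :: "'a::conjugatable_field^'n^'n \<Rightarrow> enat" where
  "factor_width A = (INF k \<in> {k. 0 < k \<and> (\<exists>r. fw_decomposable k r A)}. enat k)"

definition fran :: "nat \<Rightarrow> 'a::conjugatable_field^'n^'n \<Rightarrow> enat" where
  "fran k A = (INF r \<in> {r. fw_decomposable k r A}. enat r)"

end

theory Submission
  imports Defs
begin

text \<open>
  The Hadamard product is bilinear, and the Hadamard product of two rank-one matrices is again
  rank one: \<open>vv\<^sup>* \<odot> ww\<^sup>* = (v \<odot> w)(v \<odot> w)\<^sup>*\<close>, since conjugation is multiplicative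
  (\<open>outer_hadamard\<close>).  Expanding \<open>A = \<Sum>\<^sub>p v\<^sub>p v\<^sub>p\<^sup>*\<close> and \<open>B = \<Sum>\<^sub>q w\<^sub>q w\<^sub>q\<^sup>*\<close> therefore writes
  \<open>A \<odot> B\<close> as a sum over all pairs \<open>(p, q)\<close> of the rank-one matrices of \<open>v\<^sub>p \<odot> w\<^sub>q\<close>.  The support of
  \<open>v\<^sub>p \<odot> w\<^sub>q\<close> is contained in that of \<open>v\<^sub>p\<close>, so no vector gains non-zero entries, and there are
  \<open>r s\<close> pairs (\<open>fw_decomposable_hadamard\<close>).  Applied to minimal decompositions this gives the bound
  on the factor-width-\<open>k\<close> ranks, and their existence gives the bound on the factor width.

  The argument takes place over an arbitrary field with conjugation; the real and the complex
  statement are two instances of it.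
\<close>

lemma outer_hadamard:
  fixes v w :: "'a::conjugatable_field^'n"
  shows "outer v \<odot> outer w = outer (\<chi> i. v $ i * w $ i)"
  by (simp add: hadamard_def outer_def vec_eq_iff conjugate_dist_mul mult_ac)

lemma hadamard_sum_sum:
  fixes f :: "'i \<Rightarrow> 'a::comm_semiring_0^'n^'m"
  shows "(\<Sum>p\<in>I. f p) \<odot> (\<Sum>q\<in>J. g q) = (\<Sum>(p, q)\<in>I \<times> J. f p \<odot> g q)"
  by (simp add: hadamard_def vec_eq_iff sum_product sum.cartesian_product split_beta)

lemma nonzero_entries_mult_le:
  fixes v w :: "'a::mult_zero^'n"
  shows "nonzero_entries (\<chi> i. v $ i * w $ i) \<le> nonzero_entries v"
  unfolding nonzero_entries_def by (rule card_mono) auto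

text \<open>
  Re-indexing lets a decomposition be indexed by any finite set, in particular by pairs.
\<close>

lemma fw_decomposable_finite_index:
  fixes v :: "'i \<Rightarrow> 'a::conjugatable_field^'n"
  assumes "finite I" and "\<And>p. p \<in> I \<Longrightarrow> nonzero_entries (v p) \<le> k"
  shows "fw_decomposable k (card I) (\<Sum>p\<in>I. outer (v p))"
proof -
  obtain h where h: "bij_betw h {..<card I} I"
    using ex_bij_betw_nat_finite[OF assms(1)] by (auto simp: atLeast0LessThan)
  have "(\<Sum>p\<in>I. outer (v p)) = (\<Sum>j<card I. outer (v (h j)))"
    using sum.reindex_bij_betw[OF h, of "\<lambda>p. outer (v p)"] by simp
  moreover have "\<forall>j<card I. nonzero_entries (v (h j)) \<le> k"
    using assms(2) bij_betwE[OF h] by auto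
  ultimately show ?thesis
    unfolding fw_decomposable_def by (intro exI[of _ "\<lambda>j. v (h j)"]) auto
qed

lemma fw_decomposable_mono:
  assumes "fw_decomposable k r A" and "k \<le> l"
  shows "fw_decomposable l r A"
proof -
  obtain v where "\<forall>j<r. nonzero_entries (v j) \<le> k" and "A = (\<Sum>j<r. outer (v j))"
    using assms(1) unfolding fw_decomposable_def by blast
  then show ?thesis
    unfolding fw_decomposable_def using assms(2) by (intro exI[of _ v]) auto
qed

lemma fw_decomposable_hadamard:
  fixes A B :: "'a::conjugatable_field^'n^'n"
  assumes "fw_decomposable k r A" and "fw_decomposable l s B"
  shows "fw_decomposable k (r * s) (A \<odot> B)"
proof -
  obtain v where v: "\<And>p. p < r \<Longrightarrow> nonzero_entries (v p) \<le> k" and A: "A = (\<Sum>p<r. outer (v p))"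
    using assms(1) unfolding fw_decomposable_def by auto
  obtain w where B: "B = (\<Sum>q<s. outer (w q))"
    using assms(2) unfolding fw_decomposable_def by auto
  define u where "u = (\<lambda>(p, q). \<chi> i. v p $ i * w q $ i)"
  have "A \<odot> B = (\<Sum>pq\<in>{..<r} \<times> {..<s}. outer (u pq))"
    unfolding A B hadamard_sum_sum u_def by (simp add: outer_hadamard split_beta)
  moreover have "nonzero_entries (u pq) \<le> k" if "pq \<in> {..<r} \<times> {..<s}" for pq
    using that order_trans[OF nonzero_entries_mult_le v] by (auto simp: u_def)
  ultimately show ?thesis
    using fw_decomposable_finite_index[of "{..<r} \<times> {..<s}" u k]
    by (simp add: card_cartesian_product)
qed

text \<open>
  Infima of non-empty sets are attained in \<open>enat\<close>, so finite bounds on \<open>factor_width\<close> and \<open>fran\<close>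
  are witnessed by decompositions.
\<close>

lemma enat_INF_attained:
  fixes S :: "nat set"
  assumes "S \<noteq> {}"
  obtains m where "m \<in> S" and "(INF n\<in>S. enat n) = enat m"
proof -
  obtain n where "n \<in> S"
    using assms by auto
  then have "(INF n\<in>S. enat n) \<in> enat ` S"
    unfolding Inf_enat_def by (auto intro: LeastI)
  then show ?thesis
    using that by auto
qed

lemma factor_width_le_iff:
  assumes "0 < k"
  shows "factor_width A \<le> enat k \<longleftrightarrow> (\<exists>r. fw_decomposable k r A)"
proof
  let ?S = "{l. 0 < l \<and> (\<exists>r. fw_decomposable l r A)}"
  assume le: "factor_width A \<le> enat k"
  then have "?S \<noteq> {}"
    unfolding factor_width_def by (auto simp: top_enat_def simp del: Collect_empty_eq)
  then obtain m where "m \<in> ?S" and "factor_width A = enat m"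
    unfolding factor_width_def by (rule enat_INF_attained)
  then show "\<exists>r. fw_decomposable k r A"
    using le fw_decomposable_mono[of m _ A k] by auto
next
  assume "\<exists>r. fw_decomposable k r A"
  then show "factor_width A \<le> enat k"
    unfolding factor_width_def using assms by (intro INF_lower) auto
qed

lemma fran_le: "fw_decomposable k r A \<Longrightarrow> fran k A \<le> enat r"
  unfolding fran_def by (intro INF_lower) auto

lemma fran_attained:
  assumes "fw_decomposable k r A"
  obtains m where "fw_decomposable k m A" and "fran k A = enat m"
proof -
  have "{r. fw_decomposable k r A} \<noteq> {}"
    using assms by auto
  then show ?thesis
    by (rule enat_INF_attained) (use that in \<open>auto simp: fran_def\<close>)
qed

lemma factor_width_fran_hadamard_le:
  fixes A B :: "'a::conjugatable_field^'n^'n"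
  assumes "0 < k" and "factor_width A \<le> enat k" and "factor_width B \<le> enat k"
  shows "factor_width (A \<odot> B) \<le> enat k \<and> fran k (A \<odot> B) \<le> fran k A * fran k B"
proof -
  obtain r where r: "fw_decomposable k r A" "fran k A = enat r"
    using assms(2) unfolding factor_width_le_iff[OF assms(1)] by (blast elim: fran_attained)
  obtain s where s: "fw_decomposable k s B" "fran k B = enat s"
    using assms(3) unfolding factor_width_le_iff[OF assms(1)] by (blast elim: fran_attained)
  have "fw_decomposable k (r * s) (A \<odot> B)"
    using r(1) s(1) by (rule fw_decomposable_hadamard)
  then have "factor_width (A \<odot> B) \<le> enat k" and "fran k (A \<odot> B) \<le> enat (r * s)"
    using factor_width_le_iff[OF assms(1)] fran_le by blast+
  then show ?thesis
    by (simp add: r(2) s(2))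
qed

theorem theorem7:
  fixes k :: nat
  assumes "0 < k"
  shows
    "(\<forall>A B :: real^'n^'n.
        psd A \<longrightarrow> psd B \<longrightarrow> factor_width A \<le> enat k \<longrightarrow> factor_width B \<le> enat k \<longrightarrow>
        factor_width (A \<odot> B) \<le> enat k \<and> fran k (A \<odot> B) \<le> fran k A * fran k B) \<and>
     (\<forall>A B :: complex^'n^'n.
        psd A \<longrightarrow> psd B \<longrightarrow> factor_width A \<le> enat k \<longrightarrow> factor_width B \<le> enat k \<longrightarrow>
        factor_width (A \<odot> B) \<le> enat k \<and> fran k (A \<odot> B) \<le> fran k A * fran k B)"
  by (intro conjI[of "All _"] allI impI factor_width_fran_hadamard_le[OF assms])

end
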